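(* Let $S$ be a numerical semigroup of type $3$, and suppose $PF(S)=\{P,Q,F\}$ with $P<Q<F$ (so $F=F(S)$). Let $P(S)$ denote the number of numerical sets $T$ with $A(T)=S$. - If $P+Q-F\notin S$, then $P(S)=4$. - If $P+Q-F\in S$ and $Q-P\notin M(S)$, then $P(S)=2$. - If $P+Q-F\in S$, $Q-P\in M(S)$ and $F+P=2Q$, then $P(S)=3$. - If $P+Q-F\in S$, $Q-P\in M(S)$ and $F+P\neq 2Q$, then $P(S)=4$.
   Context: A numerical set $T$ is a subset of $\mathbb{N}_0=\{0,1,2,\dots\}$ containing $0$ with finite complement; elements of $\mathbb{N}_0\setminus T$ are its gaps, and its Frobenius number $F(T)$ is the largest gap. A numerical semigroup is a numerical set closed under addition. The atom monoid of $T$ is $A(T)=\{x\in\mathbb{N}_0 \mid x+T\subseteq T\}$. The pseudo-Frobenius numbers of $S$ are $PF(S)=\{P\in \mathbb{N}_0\setminus S \mid P+s\in S \text{ for all } s\in S\setminus\{0\}\}$; $F(S)$ is always one of them, and the type of $S$ is $t(S)=|PF(S)|$. The void of $S$ is the set $M(S)$ of gaps $a$ of $S$ such that $F(S)-a$ is also a gap of $S$. *)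

theory Defs
  imports Main
begin

definition numerical_set :: "nat set \<Rightarrow> bool" where
  "numerical_set T \<longleftrightarrow> 0 \<in> T \<and> finite (- T)"

definition numerical_semigroup :: "nat set \<Rightarrow> bool" where
  "numerical_semigroup S \<longleftrightarrow> numerical_set S \<and> (\<forall>x\<in>S. \<forall>y\<in>S. x + y \<in> S)"

definition gaps :: "nat set \<Rightarrow> nat set" where
  "gaps T = - T"

(* Meaningful only when T has at least one gap; there is no convention for T = UNIV. *)
definition frobenius_number :: "nat set \<Rightarrow> nat" where
  "frobenius_number T = Max (gaps T)"

definition atom_monoid :: "nat set \<Rightarrow> nat set" where
  "atom_monoid T = {x. (\<lambda>t. x + t) ` T \<subseteq> T}"

definition pseudo_frobenius :: "nat set \<Rightarrow> nat set" where
  "pseudo_frobenius S = {p \<in> gaps S. \<forall>s\<in>S - {0}. p + s \<in> S}"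

definition semigroup_type :: "nat set \<Rightarrow> nat" where
  "semigroup_type S = card (pseudo_frobenius S)"

(* The subtraction on nat does not truncate: every gap is at most the Frobenius number. *)
definition void :: "nat set \<Rightarrow> nat set" where
  "void S = {a \<in> gaps S. frobenius_number S - a \<in> gaps S}"

(* The collection counted here is finite for every S: A(T) = S forces T to have the same
   largest gap as S, so card never takes its default value for infinite sets. *)
definition num_associated_sets :: "nat set \<Rightarrow> nat" where
  "num_associated_sets S = card {T. numerical_set T \<and> atom_monoid T = S}"

end

theory Submission
  imports Defs
begin

text \<open>
  A set \<open>T\<close> with \<open>A(T) = S\<close> contains \<open>S\<close>, is stable under adding elements of \<open>S\<close> and omits \<open>F\<close>;
  conversely such a \<open>T\<close> satisfies \<open>A(T) = S\<close> as soon as no pseudo-Frobenius number lies in \<open>A(T)\<close>,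
  because the largest element of \<open>A(T) - S\<close> would be one. Every gap becomes pseudo-Frobenius after
  adding a suitable element of \<open>S\<close>, so \<open>T\<close> is determined by a few memberships among \<open>P\<close>, \<open>Q\<close>,
  \<open>F - P\<close>, \<open>F - Q\<close>, \<open>Q - P\<close>. The reflection \<open>T \<mapsto> {x. F - x \<notin> T}\<close> preserves
  \<open>A(T)\<close>. If \<open>P + Q - F \<notin> S\<close>, the solutions are \<open>S\<close>, its reflection,
  \<open>S \<union> (F - P + S)\<close> and \<open>S \<union> (F - Q + S)\<close>. Otherwise they are \<open>S\<close>, its reflection and, if
  \<open>Q - P\<close> lies in the void, also \<open>S \<union> (Q - P + S)\<close> and its reflection, which coincide exactly when
  \<open>F + P = 2 Q\<close>.
\<close>

section \<open>Reflection and atom monoids\<close>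

definition associated_sets :: "nat set \<Rightarrow> nat set set" where
  "associated_sets S = {T. numerical_set T \<and> atom_monoid T = S}"

text \<open>The guard \<open>x \<le> F\<close> admits everything above \<open>F\<close>; truncated
  subtraction alone would test \<open>0\<close> there.\<close>

definition reflection :: "nat \<Rightarrow> nat set \<Rightarrow> nat set" where
  "reflection F T = {x. x \<le> F \<longrightarrow> F - x \<notin> T}"

text \<open>For a numerical semigroup \<open>S\<close> this is the smallest superset of
  \<open>S\<close> that contains \<open>a\<close> and is stable under adding elements of
  \<open>S\<close>.\<close>

definition adjoin_shift :: "nat set \<Rightarrow> nat \<Rightarrow> nat set" where
  "adjoin_shift S a = S \<union> (\<lambda>s. a + s) ` S"

lemma atom_monoid_iff: "x \<in> atom_monoid T \<longleftrightarrow> (\<forall>t\<in>T. x + t \<in> T)"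
  by (auto simp: atom_monoid_def)

lemma reflection_reflection:
  assumes "\<And>x. x > F \<Longrightarrow> x \<in> T"
  shows "reflection F (reflection F T) = T"
  using assms by (auto simp: reflection_def not_le[symmetric])

text \<open>If \<open>F - (x + u)\<close> were in \<open>T\<close>, adding \<open>x\<close> would
  put \<open>F - u\<close> in \<open>T\<close>. Where reflecting twice is the identity, applying
  this twice yields equality.\<close>

lemma atom_monoid_subset_reflection:
  "atom_monoid T \<subseteq> atom_monoid (reflection F T)"
proof
  fix x assume x: "x \<in> atom_monoid T"
  have "x + u \<in> reflection F T" if u: "u \<in> reflection F T" for u
  proof -
    have False if "x + u \<le> F" "F - (x + u) \<in> T"
    proof -
      have "x + (F - (x + u)) \<in> T" using x that(2) by (simp add: atom_monoid_iff)
      moreover have "x + (F - (x + u)) = F - u" using that(1) by simp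
      ultimately show False using u that(1) by (auto simp: reflection_def)
    qed
    then show ?thesis by (auto simp: reflection_def)
  qed
  then show "x \<in> atom_monoid (reflection F T)" by (simp add: atom_monoid_iff)
qed

lemma gap_below_pseudo_frobenius:
  assumes S: "numerical_semigroup S" and x: "x \<notin> S"
  obtains s where "s \<in> S" "x + s \<in> pseudo_frobenius S"
proof -
  \<comment> \<open>The largest gap in \<open>x + S\<close> is pseudo-Frobenius, since any further
    nonzero step stays in \<open>x + S\<close> and so must land in \<open>S\<close>.\<close>
  define Y where "Y = {y. y \<notin> S \<and> (\<exists>s\<in>S. y = x + s)}"
  have fin: "finite Y"
    using S by (auto simp: Y_def numerical_semigroup_def numerical_set_def intro: finite_subset[of _ "- S"])
  have "x \<in> Y" using S x
    by (auto simp: Y_def numerical_semigroup_def numerical_set_def intro!: bexI[of _ 0])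
  then have M: "Max Y \<in> Y" using fin by (intro Max_in) auto
  then obtain s where s: "s \<in> S" "Max Y = x + s" by (auto simp: Y_def)
  have "Max Y + u \<in> S" if u: "u \<in> S - {0}" for u
  proof (rule ccontr)
    assume "Max Y + u \<notin> S"
    moreover have "s + u \<in> S" using S s u by (simp add: numerical_semigroup_def)
    ultimately have "Max Y + u \<in> Y" using s by (auto simp: Y_def add.assoc)
    then have "Max Y + u \<le> Max Y" by (rule Max_ge[OF fin])
    then show False using u by simp
  qed
  then have "Max Y \<in> pseudo_frobenius S"
    using M by (auto simp: pseudo_frobenius_def gaps_def Y_def)
  then show thesis using s that by simp
qed

lemma atom_monoid_eqI:
  assumes S: "numerical_semigroup S" and T: "0 \<in> T"
    and ideal: "\<And>s t. s \<in> S \<Longrightarrow> t \<in> T \<Longrightarrow> s + t \<in> T"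
    and pf: "\<And>p. p \<in> pseudo_frobenius S \<Longrightarrow> p \<notin> atom_monoid T"
  shows "atom_monoid T = S"
proof
  show "S \<subseteq> atom_monoid T" using ideal by (auto simp: atom_monoid_iff)
  show "atom_monoid T \<subseteq> S"
  proof (rule subsetI, rule ccontr)
    fix x assume x: "x \<in> atom_monoid T" "x \<notin> S"
    obtain s where s: "s \<in> S" "x + s \<in> pseudo_frobenius S"
      using gap_below_pseudo_frobenius[OF S x(2)] .
    have "x + s \<in> atom_monoid T"
      using x(1) ideal s(1) by (auto simp: atom_monoid_iff add.assoc)
    then show False using pf s by blast
  qed
qed

section \<open>Memberships forced in an associated set\<close>

locale type_three =
  fixes S :: "nat set" and P Q F :: nat
  assumes sg: "numerical_semigroup S"
    and pf: "pseudo_frobenius S = {P, Q, F}"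
    and PQ: "P < Q" and QF: "Q < F"
begin

lemma zero_mem: "0 \<in> S"
  and add_mem: "x \<in> S \<Longrightarrow> y \<in> S \<Longrightarrow> x + y \<in> S"
  using sg by (auto simp: numerical_semigroup_def numerical_set_def)

lemma pf_notin: "P \<notin> S" "Q \<notin> S" "F \<notin> S"
  using pf by (auto simp: pseudo_frobenius_def gaps_def)

lemma pf_add:
  assumes "s \<in> S" "s \<noteq> 0"
  shows "P + s \<in> S" "Q + s \<in> S" "F + s \<in> S"
proof -
  have "\<forall>p\<in>{P, Q, F}. p + s \<in> S"
    using assms unfolding pf[symmetric] by (auto simp: pseudo_frobenius_def)
  then show "P + s \<in> S" "Q + s \<in> S" "F + s \<in> S" by auto
qed

lemma gap_cases:
  assumes "x \<notin> S"
  obtains s where "s \<in> S" "x + s = P \<or> x + s = Q \<or> x + s = F"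
  using gap_below_pseudo_frobenius[OF sg assms] pf by auto

lemma above_F: "x > F \<Longrightarrow> x \<in> S"
  using PQ QF by (rule_tac ccontr) (erule gap_cases, auto)

lemma frobenius: "frobenius_number S = F"
  unfolding frobenius_number_def gaps_def
proof (rule Max_eqI)
  show "finite (- S)" using sg by (auto simp: numerical_semigroup_def numerical_set_def)
  show "y \<le> F" if "y \<in> - S" for y using that above_F not_le by blast
qed (use pf_notin in auto)

lemma diff_gap: "F - P \<notin> S" "F - Q \<notin> S" "Q - P \<notin> S"
  using pf_add[of "F - P"] pf_add[of "F - Q"] pf_add[of "Q - P"] pf_notin PQ QF by auto

lemma ideal: "T \<in> associated_sets S \<Longrightarrow> s \<in> S \<Longrightarrow> t \<in> T \<Longrightarrow> s + t \<in> T"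
  by (auto simp: associated_sets_def atom_monoid_iff)

lemma subset: "T \<in> associated_sets S \<Longrightarrow> S \<subseteq> T"
  using ideal[of T _ 0] by (auto simp: associated_sets_def numerical_set_def)

text \<open>For \<open>t > 0\<close> the sum \<open>F + t\<close> already lies in \<open>S\<close>,
  so \<open>F \<in> T\<close> alone would put \<open>F\<close> into the atom monoid.\<close>

lemma F_notin:
  assumes T: "T \<in> associated_sets S"
  shows "F \<notin> T"
proof
  assume F: "F \<in> T"
  have "F + t \<in> T" for t
    using F subset[OF T] above_F[of "F + t"] by (cases "t = 0") auto
  then have "F \<in> atom_monoid T" by (simp add: atom_monoid_iff)
  then show False using T pf_notin by (simp add: associated_sets_def)
qed

lemma in_void:
  assumes T: "T \<in> associated_sets S" and t: "t \<in> T" "t \<notin> S"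
  shows "F - t \<notin> S"
proof
  have "t \<le> F" using t above_F not_le by blast
  moreover assume "F - t \<in> S"
  ultimately show False using ideal[OF T _ t(1), of "F - t"] F_notin[OF T] by simp
qed

lemma void_iff: "t \<in> void S \<longleftrightarrow> t \<notin> S \<and> F - t \<notin> S"
  by (simp add: void_def gaps_def frobenius)

lemma reflection_mem:
  assumes T: "T \<in> associated_sets S"
  shows "reflection F T \<in> associated_sets S"
proof -
  have "atom_monoid (reflection F T) \<subseteq> atom_monoid (reflection F (reflection F T))"
    by (rule atom_monoid_subset_reflection)
  also have "reflection F (reflection F T) = T"
    using subset[OF T] above_F by (intro reflection_reflection) auto
  finally have "atom_monoid (reflection F T) = S"
    using atom_monoid_subset_reflection[of T F] T by (auto simp: associated_sets_def)
  moreover have "numerical_set (reflection F T)"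
    using F_notin[OF T] by (auto simp: numerical_set_def reflection_def intro: finite_subset[of _ "{..F}"])
  ultimately show ?thesis by (simp add: associated_sets_def)
qed

lemma reflection_twice: "T \<in> associated_sets S \<Longrightarrow> reflection F (reflection F T) = T"
  using subset above_F by (intro reflection_reflection) auto

lemma self_mem: "S \<in> associated_sets S"
  using sg zero_mem add_mem
  by (force simp: associated_sets_def numerical_semigroup_def atom_monoid_iff)

text \<open>A witness \<open>t\<close> for \<open>Q\<close> not being in \<open>A(T)\<close> is
  nonzero, so a shift of the gap \<open>Q + t\<close> by \<open>S\<close> can only reach
  \<open>F\<close>; this writes \<open>F - Q\<close> as \<open>s + t\<close>.\<close>

lemma complement_Q_mem:
  assumes T: "T \<in> associated_sets S" and Q: "Q \<in> T"
  shows "F - Q \<in> T"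
proof -
  have "Q \<notin> atom_monoid T" using T pf_notin by (simp add: associated_sets_def)
  then obtain t where t: "t \<in> T" "Q + t \<notin> T" by (auto simp: atom_monoid_iff)
  then have "Q + t \<notin> S" using subset[OF T] by auto
  then obtain s where s: "s \<in> S" "Q + t + s = P \<or> Q + t + s = Q \<or> Q + t + s = F"
    by (rule gap_cases)
  have "t \<noteq> 0" using t Q by (cases t) auto
  then have "F - Q = s + t" using s PQ by auto
  then show ?thesis using ideal[OF T s(1) t(1)] by simp
qed

lemma complement_or_difference_mem:
  assumes T: "T \<in> associated_sets S" and P: "P \<in> T"
  shows "F - P \<in> T \<or> Q - P \<in> T \<and> Q - P \<in> void S"
proof -
  have "P \<notin> atom_monoid T" using T pf_notin by (simp add: associated_sets_def)
  then obtain t where t: "t \<in> T" "P + t \<notin> T" by (auto simp: atom_monoid_iff)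
  then have "P + t \<notin> S" using subset[OF T] by auto
  then obtain s where s: "s \<in> S" "P + t + s = P \<or> P + t + s = Q \<or> P + t + s = F"
    by (rule gap_cases)
  have "t \<noteq> 0" using t P by (cases t) auto
  \<comment> \<open>Unlike for \<open>Q\<close>, the shift may also stop at \<open>Q\<close>, which
    is larger than \<open>P\<close>.\<close>
  then have "F - P = s + t \<or> Q - P = s + t" using s by auto
  then have "F - P \<in> T \<or> Q - P \<in> T" using ideal[OF T s(1) t(1)] by auto
  then show ?thesis using in_void[OF T, of "Q - P"] diff_gap by (auto simp: void_iff)
qed

lemma eq_self:
  assumes T: "T \<in> associated_sets S" and n: "P \<notin> T" "Q \<notin> T"
  shows "T = S"
proof
  show "S \<subseteq> T" by (rule subset[OF T])
  show "T \<subseteq> S"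
  proof (rule subsetI, rule ccontr)
    fix t assume t: "t \<in> T" "t \<notin> S"
    obtain s where "s \<in> S" "t + s = P \<or> t + s = Q \<or> t + s = F" using gap_cases[OF t(2)] .
    then show False using ideal[OF T _ t(1), of s] F_notin[OF T] n by (auto simp: add.commute)
  qed
qed

lemma eq_reflection:
  assumes T: "T \<in> associated_sets S" and n: "F - P \<in> T" "F - Q \<in> T"
  shows "T = reflection F S"
proof -
  have "reflection F T = S"
    using n PQ QF by (intro eq_self reflection_mem T) (auto simp: reflection_def)
  then show ?thesis using reflection_twice[OF T] by simp
qed

section \<open>Associated sets generated by one extra element\<close>

lemma adjoin_shift_mem:
  assumes a: "F \<notin> adjoin_shift S a"
    and "P \<notin> atom_monoid (adjoin_shift S a)" "Q \<notin> atom_monoid (adjoin_shift S a)"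
  shows "adjoin_shift S a \<in> associated_sets S"
proof -
  have 0: "0 \<in> adjoin_shift S a" using zero_mem by (simp add: adjoin_shift_def)
  have fin: "finite (- adjoin_shift S a)"
    using sg by (auto simp: adjoin_shift_def numerical_semigroup_def numerical_set_def)
  have "s + t \<in> adjoin_shift S a" if "s \<in> S" "t \<in> adjoin_shift S a" for s t
    using that add_mem by (auto simp: adjoin_shift_def image_iff)
  moreover have "F \<notin> atom_monoid (adjoin_shift S a)"
    using a 0 by (auto simp: atom_monoid_iff intro!: bexI[of _ 0])
  ultimately have "atom_monoid (adjoin_shift S a) = S"
    using 0 assms pf by (intro atom_monoid_eqI[OF sg]) auto
  with fin 0 show ?thesis by (simp add: associated_sets_def numerical_set_def)
qed

lemma adjoin_shift_subset:
  assumes "T \<in> associated_sets S" "a \<in> T"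
  shows "adjoin_shift S a \<subseteq> T"
  using assms ideal subset by (auto simp: adjoin_shift_def add.commute[of a])

text \<open>For a gap \<open>t\<close> in \<open>T\<close>, the only target of \<open>t\<close> is
  \<open>A\<close>. Since \<open>F - t\<close> is also a gap, it has a target too, and ruling out
  \<open>F\<close> and \<open>B\<close> leaves \<open>A\<close>, so \<open>t = F - A + u\<close>.
  Stating it for \<open>A\<close> and \<open>B\<close> covers both orders of \<open>P\<close> and
  \<open>Q\<close>.\<close>

lemma eq_adjoin_complement:
  assumes T: "T \<in> associated_sets S" and AB: "{A, B} = {P, Q}"
    and n: "F - A \<in> T" "B \<notin> T"
    and r: "\<forall>s\<in>S. A + B \<noteq> F + s"
  shows "T = adjoin_shift S (F - A)"
proof
  show "adjoin_shift S (F - A) \<subseteq> T" by (rule adjoin_shift_subset[OF T n(1)])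
  have AF: "A < F" "B < F" using AB PQ QF by (auto simp: doubleton_eq_iff)
  show "T \<subseteq> adjoin_shift S (F - A)"
  proof
    fix t assume t: "t \<in> T"
    show "t \<in> adjoin_shift S (F - A)"
    proof (cases "t \<in> S")
      case False
      have tF: "t \<le> F" using False above_F not_le by blast
      obtain s where s: "s \<in> S" "t + s = A \<or> t + s = B \<or> t + s = F"
        using gap_cases[OF False] AB by (metis doubleton_eq_iff)
      then have tA: "t + s = A"
        using ideal[OF T s(1) t] F_notin[OF T] n by (auto simp: add.commute)
      obtain u where u: "u \<in> S" "F - t + u = A \<or> F - t + u = B \<or> F - t + u = F"
        using gap_cases[OF in_void[OF T t False]] AB by (metis doubleton_eq_iff)
      have "F - t + u \<noteq> F" using u(1) False tF by (metis add_right_cancel le_add_diff_inverse add.commute)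
      moreover have "F - t + u \<noteq> B"
      proof
        assume "F - t + u = B"
        then have "A + B = F + (s + u)" using tA tF by simp
        then show False using r add_mem s(1) u(1) by blast
      qed
      ultimately have "t = F - A + u" using u tF AF by auto
      then show ?thesis using u by (simp add: adjoin_shift_def)
    qed (simp add: adjoin_shift_def)
  qed
qed

lemma adjoin_complement_mem:
  assumes AB: "{A, B} = {P, Q}" and r: "\<forall>s\<in>S. A + B \<noteq> F + s"
  shows "adjoin_shift S (F - A) \<in> associated_sets S"
proof -
  let ?T = "adjoin_shift S (F - A)"
  have lt: "A < F" "B < F" and g: "A \<notin> S" "B \<notin> S"
    using AB PQ QF pf_notin by (auto simp: doubleton_eq_iff)
  have "s = A" if "F = F - A + s" for s using that lt by simp
  then have F: "F \<notin> ?T" using pf_notin g by (auto simp: adjoin_shift_def)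
  have "B \<notin> ?T" using g lt r by (auto simp: adjoin_shift_def)
  then have B: "B \<notin> atom_monoid ?T"
    using zero_mem by (force simp: atom_monoid_iff adjoin_shift_def)
  have "F - A \<in> ?T" using zero_mem by (force simp: adjoin_shift_def)
  \<comment> \<open>Adding \<open>A\<close> to \<open>F - A\<close> gives the forbidden
    \<open>F\<close>.\<close>
  then have A: "A \<notin> atom_monoid ?T" using F lt by (force simp: atom_monoid_iff)
  show ?thesis using A B F AB by (intro adjoin_shift_mem) (auto simp: doubleton_eq_iff)
qed

lemma difference_notin_void:
  assumes r: "\<forall>s\<in>S. P + Q \<noteq> F + s"
  shows "Q - P \<notin> void S"
proof
  assume "Q - P \<in> void S"
  then have d: "Q - P \<notin> S" "F - (Q - P) \<notin> S" by (auto simp: void_iff)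
  obtain s where s: "s \<in> S" "Q - P + s = P \<or> Q - P + s = Q \<or> Q - P + s = F"
    using gap_cases[OF d(1)] .
  obtain u where u: "u \<in> S" "F - (Q - P) + u = P \<or> F - (Q - P) + u = Q \<or> F - (Q - P) + u = F"
    using gap_cases[OF d(2)] .
  \<comment> \<open>Only \<open>Q + s = 2 * P\<close> and \<open>F + P + u = 2 * Q\<close> survive;
    their sum contradicts the hypothesis.\<close>
  have "s \<noteq> P" "s \<noteq> F - (Q - P)" "u \<noteq> Q - P" using s u pf_notin d by auto
  then have "P + Q = F + (s + u)" using s u PQ QF by auto
  then show False using r add_mem s u by blast
qed

lemma eq_adjoin_difference:
  assumes T: "T \<in> associated_sets S" and n: "Q - P \<in> T" "Q \<notin> T"
  shows "T = adjoin_shift S (Q - P)"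
proof
  show "adjoin_shift S (Q - P) \<subseteq> T" by (rule adjoin_shift_subset[OF T n(1)])
  show "T \<subseteq> adjoin_shift S (Q - P)"
  proof
    fix t assume t: "t \<in> T"
    show "t \<in> adjoin_shift S (Q - P)"
    proof (cases "t \<in> S")
      case False
      obtain s where s: "s \<in> S" "t + s = P \<or> t + s = Q \<or> t + s = F"
        using gap_cases[OF False] .
      then have tP: "t + s = P"
        using ideal[OF T s(1) t] F_notin[OF T] n by (auto simp: add.commute)
      \<comment> \<open>Since \<open>t + s = P\<close>, adding \<open>Q - P + s\<close> to
        \<open>t\<close> would produce \<open>Q\<close>. The target of this gap can then only be
        \<open>P\<close>, and comparison with \<open>t + s = P\<close> gives
        \<open>t = Q - P + u\<close>.\<close>
      have "Q - P + s \<notin> S"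
      proof
        assume "Q - P + s \<in> S"
        from ideal[OF T this t] have "Q - P + s + t \<in> T" .
        moreover have "Q - P + s + t = Q" using tP PQ by simp
        ultimately show False using n by simp
      qed
      then obtain u where u: "u \<in> S"
        "Q - P + s + u = P \<or> Q - P + s + u = Q \<or> Q - P + s + u = F"
        by (rule gap_cases)
      have su: "s + u \<in> S" using add_mem s u by blast
      have "s + u \<noteq> P" using su pf_notin by auto
      moreover have "Q - P + s + u \<noteq> F"
        using ideal[OF T su n(1)] F_notin[OF T] by (metis add.assoc add.commute)
      ultimately have "t = Q - P + u" using u tP PQ by auto
      then show ?thesis using u by (simp add: adjoin_shift_def)
    qed (simp add: adjoin_shift_def)
  qed
qed

lemma adjoin_difference_props:
  assumes "Q - P \<in> void S"
  shows "adjoin_shift S (Q - P) \<in> associated_sets S"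
    "Q - P \<in> adjoin_shift S (Q - P)" "Q \<notin> adjoin_shift S (Q - P)"
proof -
  let ?T = "adjoin_shift S (Q - P)"
  have v: "F - (Q - P) \<notin> S" using assms by (simp add: void_iff)
  have F: "F \<notin> ?T" using pf_notin v by (auto simp: adjoin_shift_def)
  show d: "Q - P \<in> ?T" using zero_mem by (force simp: adjoin_shift_def)
  show Q: "Q \<notin> ?T"
  proof
    assume "Q \<in> ?T"
    then obtain s where "s \<in> S" "Q = Q - P + s" using pf_notin by (auto simp: adjoin_shift_def)
    moreover from this have "s = P" using PQ by simp
    ultimately show False using pf_notin by simp
  qed
  have "Q \<notin> atom_monoid ?T" using Q zero_mem by (force simp: atom_monoid_iff adjoin_shift_def)
  \<comment> \<open>Adding \<open>P\<close> to \<open>Q - P\<close> gives \<open>Q\<close>, which is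
    missing.\<close>
  moreover have "P \<notin> atom_monoid ?T"
    using d Q PQ by (force simp: atom_monoid_iff)
  ultimately show "?T \<in> associated_sets S" using F by (intro adjoin_shift_mem)
qed

lemma complement_reflection: "F - P \<in> reflection F S" "F - Q \<in> reflection F S"
  using pf_notin PQ QF by (auto simp: reflection_def)

section \<open>The case where \<open>P + Q - F\<close> is outside \<open>S\<close>\<close>

lemma card_outside:
  assumes r: "\<forall>s\<in>S. P + Q \<noteq> F + s"
  shows "card (associated_sets S) = 4"
proof -
  let ?A = "adjoin_shift S (F - P)" and ?B = "adjoin_shift S (F - Q)"
  have r': "\<forall>s\<in>S. Q + P \<noteq> F + s" using r by (simp add: add.commute)
  have sets: "associated_sets S = {S, reflection F S, ?A, ?B}"
  proof (rule subset_antisym; rule subsetI)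
    fix T assume T: "T \<in> associated_sets S"
    \<comment> \<open>Now both \<open>P\<close> and \<open>Q\<close> force their complements, so the
      four choices of which of them lie in \<open>T\<close> give the four listed sets.\<close>
    have "P \<in> T \<Longrightarrow> F - P \<in> T" using complement_or_difference_mem[OF T] difference_notin_void[OF r] by blast
    then show "T \<in> {S, reflection F S, ?A, ?B}"
      using complement_Q_mem[OF T] eq_self[OF T] eq_reflection[OF T]
        eq_adjoin_complement[OF T, of P Q] eq_adjoin_complement[OF T, of Q P] r r'
      by (auto simp: insert_commute)
  next
    fix T assume "T \<in> {S, reflection F S, ?A, ?B}"
    then show "T \<in> associated_sets S"
      using self_mem reflection_mem[OF self_mem] adjoin_complement_mem[of P Q]
        adjoin_complement_mem[of Q P] r r' by (auto simp: insert_commute)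
  qed
  have mem: "F - P \<in> ?A" "F - Q \<in> ?B" using zero_mem by (force simp: adjoin_shift_def)+
  \<comment> \<open>\<open>F - Q\<close> is smaller than \<open>F - P\<close>, hence below the whole
    shifted copy.\<close>
  have QA: "F - Q \<notin> ?A" using diff_gap PQ QF by (auto simp: adjoin_shift_def)
  have PB: "F - P \<notin> ?B"
  proof
    assume "F - P \<in> ?B"
    then obtain s where "s \<in> S" "F - P = F - Q + s"
      using diff_gap by (auto simp: adjoin_shift_def)
    moreover from this have "s = Q - P" using PQ QF by simp
    ultimately show False using diff_gap by simp
  qed
  have "S \<noteq> reflection F S" "S \<noteq> ?A" "S \<noteq> ?B" "reflection F S \<noteq> ?A"
    "reflection F S \<noteq> ?B" "?A \<noteq> ?B"
    using mem QA PB diff_gap complement_reflection by metis+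
  then show ?thesis unfolding sets by simp
qed

section \<open>The case where \<open>P + Q - F\<close> lies in \<open>S\<close>\<close>

lemma P_mem_if_Q_mem:
  assumes T: "T \<in> associated_sets S" and r: "s \<in> S" "P + Q = F + s" and Q: "Q \<in> T"
  shows "P \<in> T"
proof -
  have "P = s + (F - Q)" using r QF by simp
  then show ?thesis using ideal[OF T r(1) complement_Q_mem[OF T Q]] by simp
qed

lemma Q_mem_if_complement_P_mem:
  assumes T: "T \<in> associated_sets S" and r: "s \<in> S" "P + Q = F + s" and P: "F - P \<in> T"
  shows "Q \<in> T"
proof -
  have "Q = s + (F - P)" using r PQ QF by simp
  then show ?thesis using ideal[OF T r(1) P] by simp
qed

lemma self_neq_reflection: "S \<noteq> reflection F S"
  using diff_gap complement_reflection by blast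

text \<open>Without \<open>P\<close> there is no \<open>Q\<close>, which leaves \<open>S\<close>;
  with \<open>F - P\<close> come \<open>Q\<close> and then \<open>F - Q\<close>, which leaves the
  reflection of \<open>S\<close>.\<close>

lemma associated_cases:
  assumes T: "T \<in> associated_sets S" and r: "s \<in> S" "P + Q = F + s"
  shows "T = S \<or> T = reflection F S \<or> P \<in> T \<and> F - P \<notin> T"
  using eq_self[OF T] eq_reflection[OF T] complement_Q_mem[OF T] P_mem_if_Q_mem[OF T r] Q_mem_if_complement_P_mem[OF T r]
  by blast

lemma card_inside_not_void:
  assumes r: "s \<in> S" "P + Q = F + s" and v: "Q - P \<notin> void S"
  shows "card (associated_sets S) = 2"
proof -
  have "associated_sets S = {S, reflection F S}"
    using associated_cases[OF _ r] complement_or_difference_mem v self_mem reflection_mem[OF self_mem] by blast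
  then show ?thesis using self_neq_reflection by simp
qed

lemma associated_sets_void:
  assumes r: "s \<in> S" "P + Q = F + s" and v: "Q - P \<in> void S"
  defines "D \<equiv> adjoin_shift S (Q - P)"
  shows "associated_sets S = {S, reflection F S, D, reflection F D}"
proof (rule subset_antisym; rule subsetI)
  fix T assume T: "T \<in> associated_sets S"
  note R = reflection_mem[OF T]
  show "T \<in> {S, reflection F S, D, reflection F D}"
  proof (cases "T = S \<or> T = reflection F S")
    case False
    then have P: "P \<in> T" "F - P \<notin> T" using associated_cases[OF T r] by auto
    show ?thesis
    proof (cases "Q \<in> T")
      case True
      \<comment> \<open>The remaining case is invariant under reflection, while \<open>Q\<close>
        drops out because \<open>F - Q \<in> T\<close>; so the argument for sets without
        \<open>Q\<close> applies to the reflection.\<close>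
      have PR: "P \<in> reflection F T" "F - P \<notin> reflection F T"
        using P PQ QF by (auto simp: reflection_def)
      have "F - Q \<notin> reflection F T" using True QF by (simp add: reflection_def)
      then have "Q \<notin> reflection F T" using complement_Q_mem[OF R] by blast
      then have "reflection F T = D"
        using complement_or_difference_mem[OF R] PR eq_adjoin_difference[OF R]
        by (auto simp: D_def)
      then show ?thesis using reflection_twice[OF T] by auto
    next
      case False
      then show ?thesis using P complement_or_difference_mem[OF T] eq_adjoin_difference[OF T]
        by (auto simp: D_def)
    qed
  qed auto
next
  note D = adjoin_difference_props[OF v, folded D_def]
  fix T assume "T \<in> {S, reflection F S, D, reflection F D}"
  then show "T \<in> associated_sets S"
    using self_mem D(1) reflection_mem by auto
qed

lemma adjoin_difference_reflection_iff:
  assumes r: "s \<in> S" "P + Q = F + s" and v: "Q - P \<in> void S"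
  defines "D \<equiv> adjoin_shift S (Q - P)"
  shows "reflection F D = D \<longleftrightarrow> F + P = 2 * Q"
proof
  note D = adjoin_difference_props[OF v, folded D_def]
  note R = reflection_mem[OF D(1)]
  show "F + P = 2 * Q" if "reflection F D = D"
  proof -
    have "F - Q \<in> D" using that D(3) QF by (auto simp: reflection_def)
    then obtain u where "u \<in> S" "F - Q = Q - P + u"
      using diff_gap by (auto simp: D_def adjoin_shift_def)
    \<comment> \<open>The void condition yields \<open>F + P + w = 2 * Q\<close>, bounding
      \<open>F + P\<close> from above; the decomposition of \<open>F - Q\<close> gives the opposite
      bound.\<close>
    have "F - (Q - P) \<notin> S" using v by (simp add: void_iff)
    then obtain w where "w \<in> S"
      "F - (Q - P) + w = P \<or> F - (Q - P) + w = Q \<or> F - (Q - P) + w = F"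
      by (rule gap_cases)
    moreover have "w \<noteq> Q - P" using \<open>w \<in> S\<close> diff_gap by auto
    ultimately show ?thesis using \<open>F - Q = Q - P + u\<close> PQ QF by auto
  qed
  show "reflection F D = D" if e: "F + P = 2 * Q"
  proof -
    \<comment> \<open>Hence \<open>Q - P \<in> D\<close> keeps \<open>Q\<close> out of the
      reflection, which is then another associated set containing \<open>Q - P\<close> but not
      \<open>Q\<close>, and such a set is unique.\<close>
    have *: "F - Q = Q - P" using e PQ QF by simp
    have "F - P \<notin> D" using Q_mem_if_complement_P_mem[OF D(1) r] D(3) by blast
    then have "P \<in> reflection F D" using PQ QF by (simp add: reflection_def)
    have "Q \<notin> reflection F D" using D(2) * QF by (simp add: reflection_def)
    moreover have "F - P \<notin> reflection F D"
      using Q_mem_if_complement_P_mem[OF R r] \<open>Q \<notin> reflection F D\<close> by blast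
    ultimately show ?thesis
      using complement_or_difference_mem[OF R \<open>P \<in> reflection F D\<close>] eq_adjoin_difference[OF R]
        by (auto simp: D_def)
  qed
qed

lemma card_inside_void:
  assumes r: "s \<in> S" "P + Q = F + s" and v: "Q - P \<in> void S"
  shows "card (associated_sets S) = (if F + P = 2 * Q then 3 else 4)"
proof -
  define D where "D = adjoin_shift S (Q - P)"
  note D = adjoin_difference_props[OF v, folded D_def]
  note sets = associated_sets_void[OF r v, folded D_def]
  have nD: "D \<noteq> S" using D(2) diff_gap by auto
  have "F - P \<notin> D" using Q_mem_if_complement_P_mem[OF D(1) r] D(3) by blast
  then have nR: "D \<noteq> reflection F S" using complement_reflection by auto
  have "reflection F D \<noteq> S" using nR reflection_twice[OF D(1)] by auto
  moreover have "reflection F D \<noteq> reflection F S"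
    using nD reflection_twice[OF D(1)] reflection_twice[OF self_mem] by metis
  ultimately show ?thesis
    using nD nR self_neq_reflection adjoin_difference_reflection_iff[OF r v, folded D_def]
    unfolding sets by (auto simp: card_insert_if)
qed

end

theorem theorem6p5:
  fixes S :: "nat set" and P Q F :: nat
  assumes "numerical_semigroup S"
    and "semigroup_type S = 3"
    and "pseudo_frobenius S = {P, Q, F}"
    and "P < Q" and "Q < F"
  shows "(int P + int Q - int F \<notin> int ` S \<longrightarrow> num_associated_sets S = 4) \<and>
    (int P + int Q - int F \<in> int ` S \<and> Q - P \<notin> void S \<longrightarrow> num_associated_sets S = 2) \<and>
    (int P + int Q - int F \<in> int ` S \<and> Q - P \<in> void S \<and> F + P = 2 * Q
      \<longrightarrow> num_associated_sets S = 3) \<and>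
    (int P + int Q - int F \<in> int ` S \<and> Q - P \<in> void S \<and> F + P \<noteq> 2 * Q
      \<longrightarrow> num_associated_sets S = 4)"
proof -
  interpret type_three S P Q F
    using assms by unfold_locales
  have num: "num_associated_sets S = card (associated_sets S)"
    by (simp add: num_associated_sets_def associated_sets_def)
  \<comment> \<open>Over the integers a negative \<open>P + Q - F\<close> is outside
    \<open>S\<close>; truncation would turn it into \<open>0\<close>, an element of
    \<open>S\<close>. The additive form avoids both.\<close>
  have "int P + int Q - int F = int s \<longleftrightarrow> P + Q = F + s" for s by linarith
  then have iff: "int P + int Q - int F \<in> int ` S \<longleftrightarrow> (\<exists>s\<in>S. P + Q = F + s)" by auto
  show ?thesis
    unfolding iff num using card_outside card_inside_not_void card_inside_void by auto
qed

end
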